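(* Let $f_1,f_2:\mathbb{R}^d\to\mathbb{R}$ be in $\mathcal{C}^1$, $x_0\in\mathbb{R}^d$, $\bar\Delta>0$, and for $i\in\{1,2\}$ let $\{\widetilde f_{i,\Delta}\}_{\Delta\in(0,\bar\Delta]}$ be a class of (differentiable) models of $f_i$. Put $F=f_1f_2$ and $\widetilde F_\Delta=\widetilde f_{1,\Delta}\widetilde f_{2,\Delta}$. Suppose that for $i\in\{1,2\}$ the class $\{\widetilde f_{i,\Delta}\}_{(0,\bar\Delta]}$ provides order-$N_i^f$ function accuracy of $f_i$ near $x_0$ and order-$N_i^g$ gradient accuracy of $f_i$ near $x_0$, where $N_i^f,N_i^g\ge0$. Then $\{\widetilde F_\Delta\}_{(0,\bar\Delta]}$ provides order-$N_F^{fg}$ gradient accuracy of $F$ near $x_0$, where $N_F^{fg}=\min\{N_1^f,N_2^f,N_1^g,N_2^g\}$.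
   Context: $\|\cdot\|$ is the Euclidean norm and $B_\Delta(x_0)$ is the closed ball of radius $\Delta$ centered at $x_0$. A class of models of $f:\mathbb{R}^d\to\mathbb{R}$ is a family of functions $\widetilde f_\Delta:\mathbb{R}^d\to\mathbb{R}$ indexed by $\Delta\in(0,\bar\Delta]$; when gradients of models appear the models are understood to be differentiable. For real $N\ge0$, the class provides order-$N$ function accuracy of $f$ near $x_0$ if there is $\kappa\ge0$ such that $|f(x)-\widetilde f_\Delta(x)|\le\kappa\Delta^N$ for all $\Delta\in(0,\bar\Delta]$ and $x\in B_\Delta(x_0)$; it provides order-$N$ gradient accuracy of $f$ near $x_0$ if there is $\kappa\ge0$ such that $\|\nabla f(x)-\nabla\widetilde f_\Delta(x)\|\le\kappa\Delta^N$ for all $\Delta\in(0,\bar\Delta]$ and $x\in B_\Delta(x_0)$. *)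

theory Defs
  imports "HOL-Analysis.Analysis"
begin

definition gradient :: "(real ^ 'd \<Rightarrow> real) \<Rightarrow> real ^ 'd \<Rightarrow> real ^ 'd" where
  "gradient f x = (THE D. GDERIV f x :> D)"

lemma gradient_eqI:
  fixes f :: "real ^ 'd \<Rightarrow> real"
  assumes "GDERIV f x :> D"
  shows "gradient f x = D"
  unfolding gradient_def
proof (rule the_equality[where P = "\<lambda>D. GDERIV f x :> D", OF assms])
  fix E assume "GDERIV f x :> E"
  then have "(\<lambda>h. inner h E) = (\<lambda>h. inner h D)"
    using assms unfolding gderiv_def by (rule has_derivative_unique)
  then have "inner h E = inner h D" for h
    by (rule fun_cong)
  then show "E = D"
    using vector_eq_ldot by blast
qed

lemma GDERIV_gradient:
  fixes f :: "real ^ 'd \<Rightarrow> real"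
  assumes "f differentiable (at x)"
  shows "GDERIV f x :> gradient f x"
proof -
  obtain L where L: "(f has_derivative L) (at x)"
    using assms unfolding differentiable_def by blast
  then have "linear L"
    by (rule has_derivative_linear)
  then have "L = (\<lambda>h. inner h (adjoint L 1))"
    by (simp add: fun_eq_iff adjoint_works)
  with L have "GDERIV f x :> adjoint L 1"
    unfolding gderiv_def by simp
  then show ?thesis
    using gradient_eqI by metis
qed

definition C1 :: "(real ^ 'd \<Rightarrow> real) \<Rightarrow> bool" where
  "C1 f \<longleftrightarrow> (\<forall>x. f differentiable (at x)) \<and> continuous_on UNIV (gradient f)"

(* A class of models is a map m :: real => real^'d => real; only its values m \<Delta> with
   \<Delta> in {0<..\<Delta>max} are relevant. *)

definition function_accuracy ::
  "real \<Rightarrow> (real ^ 'd \<Rightarrow> real) \<Rightarrow> real ^ 'd \<Rightarrow> real \<Rightarrow> (real \<Rightarrow> real ^ 'd \<Rightarrow> real) \<Rightarrow> bool" where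
  "function_accuracy N f x0 \<Delta>max m \<longleftrightarrow>
     (\<exists>\<kappa>\<ge>0. \<forall>\<Delta>\<in>{0<..\<Delta>max}. \<forall>x\<in>cball x0 \<Delta>. \<bar>f x - m \<Delta> x\<bar> \<le> \<kappa> * \<Delta> powr N)"

(* Meaningful only where f and the m \<Delta> are differentiable: gradient is unspecified elsewhere. *)
definition gradient_accuracy ::
  "real \<Rightarrow> (real ^ 'd \<Rightarrow> real) \<Rightarrow> real ^ 'd \<Rightarrow> real \<Rightarrow> (real \<Rightarrow> real ^ 'd \<Rightarrow> real) \<Rightarrow> bool" where
  "gradient_accuracy N f x0 \<Delta>max m \<longleftrightarrow>
     (\<exists>\<kappa>\<ge>0. \<forall>\<Delta>\<in>{0<..\<Delta>max}. \<forall>x\<in>cball x0 \<Delta>.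
        norm (gradient f x - gradient (m \<Delta>) x) \<le> \<kappa> * \<Delta> powr N)"

end

theory Submission
  imports Defs
begin

text \<open>By the product rule, the gradient error of the product is the sum of two terms of one
  shape: exact value times exact gradient, minus model value times model gradient. Adding and
  subtracting a mixed product splits each term into (exact value)(gradient error) + (value
  error)(model gradient). The exact values and gradients are bounded on the largest ball by
  compactness, and the model gradients are bounded because they differ from the exact ones by a
  bounded error. So each term has the common order of the value and gradient errors
  (\<open>scaleR_gradient_order_bound\<close>), and \<open>gradient_accuracy_mult\<close> adds the
  two. On a bounded range of radii an accuracy order may be lowered
  (\<open>order_bound_mono\<close>), which brings all four hypotheses to their minimum.\<close>

lemma powr_le_powr_mult_powr_diff:
  fixes \<Delta> D M N :: real
  assumes "\<Delta> \<in> {0<..D}" and "M \<le> N"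
  shows "\<Delta> powr N \<le> D powr (N - M) * \<Delta> powr M"
proof -
  have "\<Delta> powr N = \<Delta> powr (N - M) * \<Delta> powr M"
    by (simp flip: powr_add)
  also have "\<dots> \<le> D powr (N - M) * \<Delta> powr M"
    using assms by (intro mult_right_mono powr_mono2) auto
  finally show ?thesis .
qed

text \<open>The surplus factor \<Delta>^(N - M) is at most D^(N - M), its exponent being
  nonnegative, and is absorbed into the constant. The error \<open>e\<close> and region
  \<open>S\<close> are left abstract so that one argument serves both values and gradients.\<close>

lemma order_bound_mono:
  fixes D M N :: real
  assumes "\<exists>\<kappa>\<ge>0. \<forall>\<Delta>\<in>{0<..D}. \<forall>x\<in>S \<Delta>. e \<Delta> x \<le> \<kappa> * \<Delta> powr N" and "M \<le> N"
  shows "\<exists>\<kappa>\<ge>0. \<forall>\<Delta>\<in>{0<..D}. \<forall>x\<in>S \<Delta>. e \<Delta> x \<le> \<kappa> * \<Delta> powr M"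
proof -
  obtain \<kappa> where \<kappa>: "\<kappa> \<ge> 0" "\<And>\<Delta> x. \<Delta> \<in> {0<..D} \<Longrightarrow> x \<in> S \<Delta> \<Longrightarrow> e \<Delta> x \<le> \<kappa> * \<Delta> powr N"
    using assms(1) by blast
  have "e \<Delta> x \<le> (\<kappa> * D powr (N - M)) * \<Delta> powr M" if "\<Delta> \<in> {0<..D}" "x \<in> S \<Delta>" for \<Delta> x
    using \<kappa>(2)[OF that] mult_left_mono[OF powr_le_powr_mult_powr_diff[OF that(1) \<open>M \<le> N\<close>] \<kappa>(1)]
    by (simp add: mult.assoc)
  with \<kappa>(1) show ?thesis
    by (intro exI[of _ "\<kappa> * D powr (N - M)"]) auto
qed

lemma function_accuracy_mono:
  assumes "function_accuracy N f x0 D m" and "M \<le> N"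
  shows "function_accuracy M f x0 D m"
  using assms unfolding function_accuracy_def by (rule order_bound_mono)

lemma gradient_accuracy_mono:
  assumes "gradient_accuracy N f x0 D m" and "M \<le> N"
  shows "gradient_accuracy M f x0 D m"
  using assms unfolding gradient_accuracy_def by (rule order_bound_mono)

lemma gradient_mult:
  fixes f g :: "real ^ 'd \<Rightarrow> real"
  assumes "f differentiable (at x)" and "g differentiable (at x)"
  shows "gradient (\<lambda>x. f x * g x) x = f x *\<^sub>R gradient g x + g x *\<^sub>R gradient f x"
  by (intro gradient_eqI GDERIV_mult GDERIV_gradient assms)

text \<open>A continuous image of a compact ball is bounded; this is where \<open>C1\<close> enters
  beyond plain differentiability.\<close>

lemma C1_bounded_on_cball:
  fixes f :: "real ^ 'd \<Rightarrow> real"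
  assumes "C1 f"
  obtains A where "A \<ge> 0" "\<And>x. x \<in> cball x0 r \<Longrightarrow> \<bar>f x\<bar> \<le> A"
    "\<And>x. x \<in> cball x0 r \<Longrightarrow> norm (gradient f x) \<le> A"
proof -
  have "continuous_on (cball x0 r) f"
    using assms unfolding C1_def
    by (intro continuous_at_imp_continuous_on ballI differentiable_imp_continuous_within) auto
  moreover have "continuous_on (cball x0 r) (gradient f)"
    using assms unfolding C1_def by (auto intro: continuous_on_subset)
  ultimately have "bounded (f ` cball x0 r)" "bounded (gradient f ` cball x0 r)"
    by (auto intro!: compact_imp_bounded compact_continuous_image)
  then obtain a b where "\<forall>x\<in>cball x0 r. \<bar>f x\<bar> \<le> a" "\<forall>x\<in>cball x0 r. norm (gradient f x) \<le> b"
    unfolding bounded_iff by auto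
  \<comment> \<open>The absolute values make the witness nonnegative even for an empty ball, where
    \<open>a\<close> and \<open>b\<close> are arbitrary.\<close>
  then show thesis
    by (intro that[of "\<bar>a\<bar> + \<bar>b\<bar>"]) force+
qed

text \<open>Only the exact data \<open>a\<close> and \<open>v\<close> have bounds assumed in
  advance. Splitting the difference as a(v - w) + (a - b)w leaves \<open>w\<close> to be bounded,
  and the triangle inequality gives V + \<beta> for it.\<close>

lemma norm_scaleR_diff_le:
  fixes v w :: "'a :: real_normed_vector"
  assumes "\<bar>a\<bar> \<le> A" and "norm v \<le> V" and "\<bar>a - b\<bar> \<le> \<alpha>" and "norm (v - w) \<le> \<beta>"
  shows "norm (a *\<^sub>R v - b *\<^sub>R w) \<le> A * \<beta> + \<alpha> * (V + \<beta>)"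
proof -
  have "norm w \<le> V + \<beta>"
    using assms(2,4) norm_triangle_sub[of w v] by (simp add: norm_minus_commute)
  have "a *\<^sub>R v - b *\<^sub>R w = a *\<^sub>R (v - w) + (a - b) *\<^sub>R w"
    by (simp add: algebra_simps)
  then have "norm (a *\<^sub>R v - b *\<^sub>R w) \<le> \<bar>a\<bar> * norm (v - w) + \<bar>a - b\<bar> * norm w"
    by (metis norm_scaleR norm_triangle_ineq)
  also have "\<dots> \<le> A * \<beta> + \<alpha> * (V + \<beta>)"
    using assms \<open>norm w \<le> V + \<beta>\<close> by (intro add_mono mult_mono) auto
  finally show ?thesis .
qed

text \<open>Half of the product rule error. The lemma is asymmetric in its two factors: values of
  one, gradients of the other.\<close>

lemma scaleR_gradient_order_bound:
  fixes f g :: "real ^ 'd \<Rightarrow> real"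
  assumes "C1 f" and "C1 g" and "N \<ge> 0"
    and "function_accuracy N f x0 D p" and "gradient_accuracy N g x0 D q"
  obtains K where "K \<ge> 0"
    "\<And>\<Delta> x. \<Delta> \<in> {0<..D} \<Longrightarrow> x \<in> cball x0 \<Delta> \<Longrightarrow>
       norm (f x *\<^sub>R gradient g x - p \<Delta> x *\<^sub>R gradient (q \<Delta>) x) \<le> K * \<Delta> powr N"
proof -
  obtain A where A: "A \<ge> 0" "\<And>x. x \<in> cball x0 D \<Longrightarrow> \<bar>f x\<bar> \<le> A"
    using C1_bounded_on_cball[OF \<open>C1 f\<close>] by metis
  obtain V where V: "V \<ge> 0" "\<And>x. x \<in> cball x0 D \<Longrightarrow> norm (gradient g x) \<le> V"
    using C1_bounded_on_cball[OF \<open>C1 g\<close>] by metis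
  obtain \<alpha> where \<alpha>: "\<alpha> \<ge> 0"
    "\<And>\<Delta> x. \<Delta> \<in> {0<..D} \<Longrightarrow> x \<in> cball x0 \<Delta> \<Longrightarrow> \<bar>f x - p \<Delta> x\<bar> \<le> \<alpha> * \<Delta> powr N"
    using assms(4) unfolding function_accuracy_def by blast
  obtain \<beta> where \<beta>: "\<beta> \<ge> 0"
    "\<And>\<Delta> x. \<Delta> \<in> {0<..D} \<Longrightarrow> x \<in> cball x0 \<Delta> \<Longrightarrow>
       norm (gradient g x - gradient (q \<Delta>) x) \<le> \<beta> * \<Delta> powr N"
    using assms(5) unfolding gradient_accuracy_def by blast
  have "norm (f x *\<^sub>R gradient g x - p \<Delta> x *\<^sub>R gradient (q \<Delta>) x)
      \<le> (A * \<beta> + \<alpha> * (V + \<beta> * D powr N)) * \<Delta> powr N"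
    if \<Delta>: "\<Delta> \<in> {0<..D}" and x: "x \<in> cball x0 \<Delta>" for \<Delta> x
  proof -
    \<comment> \<open>All the balls lie in the largest one, so \<open>A\<close> and \<open>V\<close>
      do not depend on \<Delta>.\<close>
    have "x \<in> cball x0 D"
      using \<Delta> x by auto
    then have "norm (f x *\<^sub>R gradient g x - p \<Delta> x *\<^sub>R gradient (q \<Delta>) x)
        \<le> A * (\<beta> * \<Delta> powr N) + \<alpha> * \<Delta> powr N * (V + \<beta> * \<Delta> powr N)"
      by (intro norm_scaleR_diff_le A(2) V(2) \<alpha>(2) \<beta>(2) \<Delta> x)
    \<comment> \<open>In the product of the two errors one factor \<Delta>^N is replaced by D^N,
      using N \<ge> 0, so that a single power remains.\<close>
    also have "\<dots> \<le> A * (\<beta> * \<Delta> powr N) + \<alpha> * \<Delta> powr N * (V + \<beta> * D powr N)"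
      using \<Delta> \<alpha>(1) \<beta>(1) \<open>N \<ge> 0\<close> by (intro add_left_mono mult_left_mono powr_mono2) auto
    finally show ?thesis
      by (simp add: algebra_simps)
  qed
  with A(1) V(1) \<alpha>(1) \<beta>(1) show thesis
    by (intro that[of "A * \<beta> + \<alpha> * (V + \<beta> * D powr N)"]) auto
qed

lemma gradient_accuracy_mult:
  fixes f g :: "real ^ 'd \<Rightarrow> real"
  assumes "C1 f" and "C1 g" and "N \<ge> 0"
    and p: "\<And>\<Delta> x. \<Delta> \<in> {0<..D} \<Longrightarrow> p \<Delta> differentiable (at x)"
    and q: "\<And>\<Delta> x. \<Delta> \<in> {0<..D} \<Longrightarrow> q \<Delta> differentiable (at x)"
    and "function_accuracy N f x0 D p" and "function_accuracy N g x0 D q"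
    and "gradient_accuracy N f x0 D p" and "gradient_accuracy N g x0 D q"
  shows "gradient_accuracy N (\<lambda>x. f x * g x) x0 D (\<lambda>\<Delta> x. p \<Delta> x * q \<Delta> x)"
proof -
  obtain K where K: "K \<ge> 0"
    "\<And>\<Delta> x. \<Delta> \<in> {0<..D} \<Longrightarrow> x \<in> cball x0 \<Delta> \<Longrightarrow>
       norm (f x *\<^sub>R gradient g x - p \<Delta> x *\<^sub>R gradient (q \<Delta>) x) \<le> K * \<Delta> powr N"
    using scaleR_gradient_order_bound[of f g N x0 D p q] assms by metis
  \<comment> \<open>The same estimate with the two factors exchanged.\<close>
  obtain L where L: "L \<ge> 0"
    "\<And>\<Delta> x. \<Delta> \<in> {0<..D} \<Longrightarrow> x \<in> cball x0 \<Delta> \<Longrightarrow>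
       norm (g x *\<^sub>R gradient f x - q \<Delta> x *\<^sub>R gradient (p \<Delta>) x) \<le> L * \<Delta> powr N"
    using scaleR_gradient_order_bound[of g f N x0 D q p] assms by metis
  have "norm (gradient (\<lambda>x. f x * g x) x - gradient (\<lambda>x. p \<Delta> x * q \<Delta> x) x)
      \<le> (K + L) * \<Delta> powr N"
    if \<Delta>: "\<Delta> \<in> {0<..D}" and x: "x \<in> cball x0 \<Delta>" for \<Delta> x
  proof -
    have "gradient (\<lambda>x. f x * g x) x = f x *\<^sub>R gradient g x + g x *\<^sub>R gradient f x"
      using assms(1,2) by (intro gradient_mult) (auto simp: C1_def)
    moreover have "gradient (\<lambda>x. p \<Delta> x * q \<Delta> x) x
        = p \<Delta> x *\<^sub>R gradient (q \<Delta>) x + q \<Delta> x *\<^sub>R gradient (p \<Delta>) x"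
      by (intro gradient_mult p q \<Delta>)
    ultimately show ?thesis
      using norm_diff_triangle_ineq[of "f x *\<^sub>R gradient g x" "g x *\<^sub>R gradient f x"
          "p \<Delta> x *\<^sub>R gradient (q \<Delta>) x" "q \<Delta> x *\<^sub>R gradient (p \<Delta>) x"]
        K(2)[OF \<Delta> x] L(2)[OF \<Delta> x]
      by (simp add: distrib_right)
  qed
  with K(1) L(1) show ?thesis
    unfolding gradient_accuracy_def by (intro exI[of _ "K + L"]) auto
qed

theorem theorem10:
  fixes f1 f2 :: "real ^ 'd \<Rightarrow> real"
    and m1 m2 :: "real \<Rightarrow> real ^ 'd \<Rightarrow> real"
    and x0 :: "real ^ 'd"
    and \<Delta>max N1f N2f N1g N2g :: real
  assumes "C1 f1" and "C1 f2"
    and "\<Delta>max > 0"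
    and "\<And>\<Delta> x. \<Delta> \<in> {0<..\<Delta>max} \<Longrightarrow> m1 \<Delta> differentiable (at x)"
    and "\<And>\<Delta> x. \<Delta> \<in> {0<..\<Delta>max} \<Longrightarrow> m2 \<Delta> differentiable (at x)"
    and "N1f \<ge> 0" and "N2f \<ge> 0" and "N1g \<ge> 0" and "N2g \<ge> 0"
    and "function_accuracy N1f f1 x0 \<Delta>max m1"
    and "function_accuracy N2f f2 x0 \<Delta>max m2"
    and "gradient_accuracy N1g f1 x0 \<Delta>max m1"
    and "gradient_accuracy N2g f2 x0 \<Delta>max m2"
  shows "gradient_accuracy (Min {N1f, N2f, N1g, N2g})
           (\<lambda>x. f1 x * f2 x) x0 \<Delta>max (\<lambda>\<Delta> x. m1 \<Delta> x * m2 \<Delta> x)"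
proof -
  let ?N = "Min {N1f, N2f, N1g, N2g}"
  have "?N \<ge> 0" and "?N \<le> N1f" "?N \<le> N2f" "?N \<le> N1g" "?N \<le> N2g"
    using assms(6-9) by simp_all
  \<comment> \<open>All four accuracies are lowered to the common order \<open>?N\<close>.\<close>
  then show ?thesis
    using assms(1,2,4,5,10-13)
    by (intro gradient_accuracy_mult) (auto intro: function_accuracy_mono gradient_accuracy_mono simp del: Min_insert)
qed

end
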